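(* Let $\varphi\in L^\infty(\mathbb{R})$, $\Phi(x)=\int_0^x\varphi(\xi)\,d\xi$, and let $\bar\Phi$ be the convex hull of $\Phi$ over $(-\infty,\infty)$. (i) If $\bar\Phi(x)>-\infty$ on $\mathbb{R}$, then $c\in\mathcal{D}(x_0)$ if and only if $$\Phi(x_0)=\bar\Phi(x_0)\quad\text{and}\quad\mathrm D_-\bar\Phi(x_0)\le c\le\mathrm D_+\bar\Phi(x_0).$$ (ii) If $\bar\Phi\equiv-\infty$, then $\mathcal{D}(x_0)=\varnothing$ for any $x_0\in\mathbb{R}$.
   Context: Setting: $f\in C^2(\mathbb{R})$, $f''\ge0$, $\mathcal{L}\{f''=0\}=0$ (Lebesgue measure), so $f'$ is strictly increasing. For $t>0$: $E(u;x,t)=t\int_0^u f''(s)(\varphi(x-tf'(s))-s)\,ds$, and $\mathcal{U}(x,t)$ is the (nonempty compact) set of maximizers of $E(\cdot\,;x,t)$ over $\mathbb{R}$. $L_c(x_0)=\{(x,t):x=x_0+tf'(c),\ t>0\}$; the set of divide generation values of $x_0$ is $\mathcal{D}(x_0)=\{c\in\mathbb{R}:\mathcal{U}(x,t)=\{c\}\text{ for all }(x,t)\in L_c(x_0),\ t>0\}$ (for $c\in\mathcal{D}(x_0)$, $L_c(x_0)$ is called a divide). Convex hull: $\bar\Phi(x)=\lim_{N\to\infty}\bar\Phi_N(x)\in[-\infty,\infty)$, where $\bar\Phi_N$ equals the convex hull (largest convex minorant) of $\Phi|_{[-N,N]}$ on $[-N,N]$ and equals $\Phi$ for $|x|\ge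 N$. When finite, $\bar\Phi$ is convex, and $\mathrm D_\pm\bar\Phi(x_0)$ denote its right/left derivatives at $x_0$. *)

theory Defs
  imports "HOL-Analysis.Analysis"
begin

definition C2 :: "(real \<Rightarrow> real) \<Rightarrow> bool" where
  "C2 f \<longleftrightarrow> (\<forall>x. f differentiable at x) \<and> (\<forall>x. deriv f differentiable at x)
     \<and> continuous_on UNIV (deriv (deriv f))"

text \<open>Representatives of elements of \<open>L\<^sup>\<infinity>(\<real>)\<close>: Lebesgue (not necessarily Borel) measurable,
  bounded off a null set. Accordingly all integrals below are taken with respect to
  \<^const>\<open>lebesgue\<close>; with \<^const>\<open>lborel\<close> a representative that is not Borel would get
  the junk integral 0.\<close>

definition L_infinity :: "(real \<Rightarrow> real) \<Rightarrow> bool" where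
  "L_infinity \<phi> \<longleftrightarrow> \<phi> \<in> borel_measurable lebesgue \<and> (\<exists>M. AE x in lebesgue. \<bar>\<phi> x\<bar> \<le> M)"

definition primitive :: "(real \<Rightarrow> real) \<Rightarrow> real \<Rightarrow> real" where
  "primitive \<phi> x = (LINT \<xi>=0..x|lebesgue. \<phi> \<xi>)"

definition E_val :: "(real \<Rightarrow> real) \<Rightarrow> (real \<Rightarrow> real) \<Rightarrow> real \<Rightarrow> real \<Rightarrow> real \<Rightarrow> real" where
  "E_val f \<phi> u x t =
     t * (LINT s=0..u|lebesgue. (deriv (deriv f) s * (\<phi> (x - t * deriv f s) - s)))"

definition maximizers :: "(real \<Rightarrow> real) \<Rightarrow> (real \<Rightarrow> real) \<Rightarrow> real \<Rightarrow> real \<Rightarrow> real set" where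
  "maximizers f \<phi> x t = {u. \<forall>v. E_val f \<phi> v x t \<le> E_val f \<phi> u x t}"

definition divide_line :: "(real \<Rightarrow> real) \<Rightarrow> real \<Rightarrow> real \<Rightarrow> (real \<times> real) set" where
  "divide_line f c x0 = {(x, t). x = x0 + t * deriv f c \<and> t > 0}"

definition divide_values :: "(real \<Rightarrow> real) \<Rightarrow> (real \<Rightarrow> real) \<Rightarrow> real \<Rightarrow> real set" where
  "divide_values f \<phi> x0 = {c. \<forall>(x, t) \<in> divide_line f c x0. maximizers f \<phi> x t = {c}}"

text \<open>The largest convex minorant of \<open>g\<close> on \<open>S\<close>, as the pointwise supremum of all convex
  minorants. The supremum is taken in the reals, so it is meaningful only at points of \<open>S\<close> and
  when a convex minorant exists (e.g. when \<open>g\<close> is bounded below on the convex set \<open>S\<close>).\<close>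

definition convex_minorant_on :: "real set \<Rightarrow> (real \<Rightarrow> real) \<Rightarrow> real \<Rightarrow> real" where
  "convex_minorant_on S g x = Sup {h x |h. convex_on S h \<and> (\<forall>y\<in>S. h y \<le> g y)}"

definition truncated_hull :: "(real \<Rightarrow> real) \<Rightarrow> nat \<Rightarrow> real \<Rightarrow> real" where
  "truncated_hull g N x =
     (if \<bar>x\<bar> \<le> real N then convex_minorant_on {- real N..real N} g x else g x)"

definition convex_hull_fun :: "(real \<Rightarrow> real) \<Rightarrow> real \<Rightarrow> ereal" where
  "convex_hull_fun g x = lim (\<lambda>N. ereal (truncated_hull g N x))"

definition right_deriv :: "(real \<Rightarrow> real) \<Rightarrow> real \<Rightarrow> real" where
  "right_deriv g x = Lim (at_right x) (\<lambda>y. (g y - g x) / (y - x))"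

definition left_deriv :: "(real \<Rightarrow> real) \<Rightarrow> real \<Rightarrow> real" where
  "left_deriv g x = Lim (at_left x) (\<lambda>y. (g y - g x) / (y - x))"

end

theory Submission imports Defs begin

text \<open>Substituting \<open>\<xi> = x - t f'(s)\<close> in \<open>E\<close> gives, for \<open>(x, t) \<in> L\<^sub>c(x\<^sub>0)\<close> and
  \<open>y = x\<^sub>0 - t (f'(u) - f'(c))\<close>,
  \<open>E(u) - E(c) = \<Phi>(x\<^sub>0) + c (y - x\<^sub>0) - \<Phi>(y) - t G(u)\<close>,
  where \<open>G(u) = (u - c) f'(u) - f(u) + f(c)\<close> lies in \<open>(0, (u - c)(f'(u) - f'(c))]\<close> for \<open>u \<noteq> c\<close>.
  If the line of slope \<open>c\<close> through \<open>(x\<^sub>0, \<Phi>(x\<^sub>0))\<close> supports \<open>\<Phi>\<close>, the difference is thus negative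
  for \<open>u \<noteq> c\<close>. Conversely, fixing \<open>y\<close> and letting \<open>u \<rightarrow> c\<close> (so \<open>t \<rightarrow> \<infinity>\<close>) makes \<open>t G(u)\<close> vanish,
  so a divide forces the line to support \<open>\<Phi>\<close>. A supporting line is an affine minorant of \<open>\<Phi>\<close>,
  hence of its convex hull, and is thereby a subgradient of the hull at a contact point;
  in particular none exists when the hull is \<open>-\<infinity>\<close>.\<close>

section \<open>The primitive of an essentially bounded function\<close>

lemma interval_integral_lebesgue_eq_integral:
  fixes g :: "real \<Rightarrow> real"
  assumes "a \<le> b" "set_integrable lebesgue {a..b} g"
  shows "(LINT s=a..b|lebesgue. g s) = integral {a..b} g"
proof -
  \<comment> \<open>The interval integral runs over the open interval; its endpoints are negligible
    for the gauge integral, in which the substitution below is carried out.\<close>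
  have "set_integrable lebesgue {a<..<b} g"
    by (rule set_integrable_subset[OF assms(2)]) auto
  then have "(LINT s=a..b|lebesgue. g s) = integral {a<..<b} g"
    using assms(1) by (simp add: interval_lebesgue_integral_le_eq set_lebesgue_integral_eq_integral)
  then show ?thesis by (simp add: integral_open_interval_real)
qed

lemma L_infinity_set_integrable:
  assumes "L_infinity \<phi>"
  shows "set_integrable lebesgue {a..b} \<phi>"
proof -
  obtain M where M: "\<phi> \<in> borel_measurable lebesgue" "AE x in lebesgue. \<bar>\<phi> x\<bar> \<le> M"
    using assms unfolding L_infinity_def by auto
  have "set_integrable lebesgue {a..b} (\<lambda>_. M)"
    by (rule absolutely_integrable_on_const) simp
  then show ?thesis
    by (rule set_integrable_bound) (use M in \<open>auto simp: set_borel_measurable_def intro!: borel_measurable_times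
        borel_measurable_indicator\<close>)
qed

text \<open>Orientation makes \<open>primitive\<close> a negated integral left of 0, so additivity
  over adjacent intervals is applied according to the position of 0 relative to \<open>a\<close> and
  \<open>b\<close>.\<close>

lemma primitive_diff:
  assumes "L_infinity \<phi>" "a \<le> b"
  shows "primitive \<phi> b - primitive \<phi> a = integral {a..b} \<phi>"
proof -
  note si = L_infinity_set_integrable[OF assms(1)]
  note I = set_lebesgue_integral_eq_integral(1)[OF si]
  have pos: "primitive \<phi> x = integral {0..x} \<phi>" if "0 \<le> x" for x
    using interval_integral_lebesgue_eq_integral[OF that si] by (simp add: primitive_def zero_ereal_def)
  have neg: "primitive \<phi> x = - integral {x..0} \<phi>" if "x < 0" for x
    using interval_integral_lebesgue_eq_integral[OF _ si, of x 0] that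
    by (simp add: primitive_def zero_ereal_def interval_lebesgue_integral_gt_eq')
  consider "0 \<le> a" | "a < 0" "0 \<le> b" | "b < 0" by linarith
  then show ?thesis
  proof cases
    case 1
    then show ?thesis
      using Henstock_Kurzweil_Integration.integral_combine[OF 1 assms(2) I] assms(2) by (simp add: pos)
  next
    case 2
    then show ?thesis
      using Henstock_Kurzweil_Integration.integral_combine[of a 0 b, OF _ _ I] by (simp add: pos neg)
  next
    case 3
    then show ?thesis
      using Henstock_Kurzweil_Integration.integral_combine[of a b 0, OF _ _ I] assms(2) by (simp add: neg)
  qed
qed

text \<open>Supplies a constant convex minorant on each truncation interval, so that the real
  supremum defining the truncated hull is meaningful. The essential bound of \<phi> is a Lipschitz
  constant of the primitive.\<close>

lemma primitive_bounded_below: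
  assumes "L_infinity \<phi>"
  obtains m where "\<And>N y. y \<in> {- real N..real N} \<Longrightarrow> m N \<le> primitive \<phi> y"
proof -
  obtain M where M: "AE x in lebesgue. \<bar>\<phi> x\<bar> \<le> M"
    using assms unfolding L_infinity_def by auto
  note si = L_infinity_set_integrable[OF assms]
  have lip: "\<bar>primitive \<phi> b - primitive \<phi> a\<bar> \<le> M * (b - a)" if "a \<le> b" for a b
  proof -
    have "\<bar>LINT x:{a..b}|lebesgue. \<phi> x\<bar> \<le> (LINT x:{a..b}|lebesgue. \<bar>\<phi> x\<bar>)"
      using set_integral_norm_bound[OF si] by simp
    also have "\<dots> \<le> (LINT x:{a..b}|lebesgue. M)"
      by (rule set_integral_mono_AE)
        (use M si in \<open>auto intro: absolutely_integrable_on_const set_integrable_abs\<close>)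
    also have "\<dots> = M * (b - a)"
      using that by (simp add: set_lebesgue_integral_def mult.commute)
    finally show ?thesis
      using primitive_diff[OF assms that] set_lebesgue_integral_eq_integral(2)[OF si] by simp
  qed
  have "primitive \<phi> (- real N) - M * (2 * real N) \<le> primitive \<phi> y"
    if "y \<in> {- real N..real N}" for N y
  proof -
    \<comment> \<open>The essential bound is not assumed nonnegative; the Lipschitz estimate on the
      unit interval forces it.\<close>
    have "0 \<le> M" using lip[of 0 1] by simp
    then have "M * (y + real N) \<le> M * (2 * real N)"
      using that by (intro mult_left_mono) auto
    then show ?thesis using lip[of "- real N" y] that by simp
  qed
  then show thesis by (rule that)
qed

section \<open>The functional E along characteristics and divides as supporting lines\<close>

context
  fixes f :: "real \<Rightarrow> real"
  assumes f: "C2 f"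
begin

lemma C2_DERIV: "(f has_real_derivative deriv f x) (at x)"
  using f by (simp add: C2_def DERIV_deriv_iff_real_differentiable)

lemma C2_DERIV2: "(deriv f has_real_derivative deriv (deriv f) x) (at x)"
  using f by (simp add: C2_def DERIV_deriv_iff_real_differentiable)

text \<open>Equal values of the nondecreasing \<open>deriv f\<close> at \<open>a < b\<close> would
  make it constant between them, so f'' would vanish on an interval of positive measure.\<close>

lemma C2_deriv_strict_mono:
  assumes nonneg: "\<forall>s. deriv (deriv f) s \<ge> 0"
    and null: "{s. deriv (deriv f) s = 0} \<in> null_sets lebesgue"
  shows "strict_mono (deriv f)"
proof (rule strict_monoI)
  fix a b :: real assume "a < b"
  have mono: "deriv f x \<le> deriv f y" if "x \<le> y" for x y
    by (rule DERIV_nonneg_imp_nondecreasing[OF that]) (use C2_DERIV2 nonneg in blast)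
  show "deriv f a < deriv f b"
  proof (rule ccontr)
    assume "\<not> deriv f a < deriv f b"
    then have const: "deriv f s = deriv f a" if "s \<in> {a..b}" for s
      using mono[of a s] mono[of s b] that by (intro order_antisym) auto
    have "deriv (deriv f) s = 0" if "s \<in> {a<..<b}" for s
    proof -
      have eq: "deriv f x = deriv f a" if "x \<in> {a<..<b}" for x
        by (rule const) (use that in simp)
      have "((\<lambda>_. deriv f a) has_real_derivative deriv (deriv f) s) (at s)"
        by (rule has_field_derivative_transform_within_open[OF C2_DERIV2 open_greaterThanLessThan that eq])
      then show ?thesis by (rule DERIV_unique) (rule DERIV_const)
    qed
    then have "{a<..<b} \<subseteq> {s. deriv (deriv f) s = 0}"
      by blast
    then have "{a<..<b} \<in> null_sets lebesgue"
      by (intro null_sets_subset[OF null]) simp_all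
    then show False using \<open>a < b\<close> by (simp add: null_sets_def)
  qed
qed

text \<open>The \<phi>-term is computed by the decreasing substitution \<xi> = x - t f'(s), whose
  Jacobian is t f''(s). The remaining term s f''(s) has the antiderivative s f'(s) - f(s), the
  Legendre transform of f at f'(s).\<close>

lemma integral_along_characteristic:
  fixes a b t x :: real
  assumes sm: "strict_mono (deriv f)" and nonneg: "\<forall>s. deriv (deriv f) s \<ge> 0"
    and \<phi>: "L_infinity \<phi>" and t: "t > 0" and ab: "a \<le> b"
  defines "g \<equiv> \<lambda>s. deriv (deriv f) s * (\<phi> (x - t * deriv f s) - s)"
  shows "set_integrable lebesgue {a..b} g"
    "t * integral {a..b} g
      = primitive \<phi> (x - t * deriv f a) - primitive \<phi> (x - t * deriv f b)
        - t * ((b * deriv f b - f b) - (a * deriv f a - f a))"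
proof -
  define \<psi> where "\<psi> = (\<lambda>s. x - t * deriv f s)"
  have der: "(\<psi> has_real_derivative - t * deriv (deriv f) s) (at s within S)" for s S
    unfolding \<psi>_def by (auto intro!: derivative_eq_intros has_field_derivative_at_within[OF C2_DERIV2])
  have dec: "\<psi> v \<le> \<psi> u" if "u \<le> v" for u v
    using that t strict_mono_less_eq[OF sm] by (simp add: \<psi>_def)
  have inj: "inj_on \<psi> {a..b}"
    using strict_mono_eq[OF sm] t by (auto simp: inj_on_def \<psi>_def)
  have cont: "continuous_on {a..b} \<psi>"
    using der by (intro DERIV_continuous_on) auto
  have img: "\<psi> ` {a..b} = {\<psi> b..\<psi> a}"
  proof
    show "\<psi> ` {a..b} \<subseteq> {\<psi> b..\<psi> a}" using dec by auto
    show "{\<psi> b..\<psi> a} \<subseteq> \<psi> ` {a..b}"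
    proof
      fix y assume "y \<in> {\<psi> b..\<psi> a}"
      then show "y \<in> \<psi> ` {a..b}"
        using IVT2'[of \<psi> b y a] ab cont by (auto simp: image_iff)
    qed
  qed
  \<comment> \<open>This change of variables rests on injectivity of \<open>\<psi>\<close>, so
    isolated or null zeros of f'' do no harm. It yields integrability on the left from that of
    \<phi> on the image.\<close>
  have *: "(\<lambda>s. \<bar>- t * deriv (deriv f) s\<bar> * \<phi> (\<psi> s)) absolutely_integrable_on {a..b}"
    "integral {a..b} (\<lambda>s. \<bar>- t * deriv (deriv f) s\<bar> * \<phi> (\<psi> s)) = integral {\<psi> b..\<psi> a} \<phi>"
    using has_absolute_integral_change_of_variables_1'[of "{a..b}" \<psi> "\<lambda>s. - t * deriv (deriv f) s"
        \<phi> "integral {\<psi> b..\<psi> a} \<phi>"] der inj L_infinity_set_integrable[OF \<phi>] by (auto simp: img)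
  have abs: "\<bar>- t * deriv (deriv f) s\<bar> = t * deriv (deriv f) s" for s
    using t nonneg by (simp add: abs_mult)
  have c2: "continuous_on {a..b} (deriv (deriv f))"
    using f by (auto simp: C2_def intro: continuous_on_subset)
  have lin: "(\<lambda>s. t * (s * deriv (deriv f) s)) absolutely_integrable_on {a..b}"
    by (intro absolutely_integrable_continuous_real continuous_intros c2)
  have "((\<lambda>s. s * deriv (deriv f) s) has_integral
      (b * deriv f b - f b) - (a * deriv f a - f a)) {a..b}"
  proof (rule fundamental_theorem_of_calculus[OF ab])
    fix s
    have "((\<lambda>s. s * deriv f s - f s) has_real_derivative s * deriv (deriv f) s) (at s within {a..b})"
      by (auto intro!: derivative_eq_intros has_field_derivative_at_within[OF C2_DERIV2]
          has_field_derivative_at_within[OF C2_DERIV])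
    then show "((\<lambda>s. s * deriv f s - f s) has_vector_derivative s * deriv (deriv f) s) (at s within {a..b})"
      by (simp add: has_real_derivative_iff_has_vector_derivative)
  qed
  then have lin_int: "integral {a..b} (\<lambda>s. t * (s * deriv (deriv f) s))
      = t * ((b * deriv f b - f b) - (a * deriv f a - f a))"
    by (simp add: integral_unique)
  have tg: "(\<lambda>s. t * g s) = (\<lambda>s. \<bar>- t * deriv (deriv f) s\<bar> * \<phi> (\<psi> s) - t * (s * deriv (deriv f) s))"
    by (simp only: abs) (simp add: g_def \<psi>_def fun_eq_iff algebra_simps)
  have "(\<lambda>s. t * g s) absolutely_integrable_on {a..b}"
    unfolding tg by (intro set_integral_diff * lin)
  then show "set_integrable lebesgue {a..b} g"
    using t by simp
  have "t * integral {a..b} g = integral {a..b} (\<lambda>s. t * g s)"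
    by simp
  also have "\<dots> = integral {\<psi> b..\<psi> a} \<phi> - t * ((b * deriv f b - f b) - (a * deriv f a - f a))"
    unfolding tg using *(1) lin
    by (subst integral_diff) (simp_all only: *(2) lin_int set_lebesgue_integral_eq_integral(1))
  also have "integral {\<psi> b..\<psi> a} \<phi> = primitive \<phi> (\<psi> a) - primitive \<phi> (\<psi> b)"
    using primitive_diff[OF \<phi> dec[OF ab]] by simp
  finally show "t * integral {a..b} g
      = primitive \<phi> (x - t * deriv f a) - primitive \<phi> (x - t * deriv f b)
        - t * ((b * deriv f b - f b) - (a * deriv f a - f a))"
    by (simp add: \<psi>_def)
qed

lemma E_val_eq:
  assumes "strict_mono (deriv f)" "\<forall>s. deriv (deriv f) s \<ge> 0" "L_infinity \<phi>" "t > 0"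
  shows "E_val f \<phi> u x t = primitive \<phi> (x - t * deriv f 0) - primitive \<phi> (x - t * deriv f u)
    - t * (u * deriv f u - f u + f 0)"
proof (cases "0 \<le> u")
  case True
  note * = integral_along_characteristic[OF assms True, of x]
  show ?thesis
    using *(2) interval_integral_lebesgue_eq_integral[OF True *(1)]
    by (simp add: E_val_def zero_ereal_def)
next
  case False
  then have u: "u \<le> 0" by simp
  note * = integral_along_characteristic[OF assms u, of x]
  show ?thesis
    using *(2) interval_integral_lebesgue_eq_integral[OF u *(1)] False
    by (simp add: E_val_def zero_ereal_def interval_lebesgue_integral_gt_eq' algebra_simps)
qed

lemma divide_values_iff:
  assumes sm: "strict_mono (deriv f)" and nonneg: "\<forall>s. deriv (deriv f) s \<ge> 0"
    and \<phi>: "L_infinity \<phi>"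
  shows "c \<in> divide_values f \<phi> x0
    \<longleftrightarrow> (\<forall>y. primitive \<phi> x0 + c * (y - x0) \<le> primitive \<phi> y)"
proof -
  define G where "G u = (u - c) * deriv f u - f u + f c" for u
  \<comment> \<open>By the mean value theorem G(u) = (u - c)(f'(u) - f'(z)) with z strictly between
    c and u; strict monotonicity of f' gives both bounds.\<close>
  have G: "0 < G u \<and> G u \<le> (u - c) * (deriv f u - deriv f c)" if "u \<noteq> c" for u
  proof (cases "c < u")
    case True
    then obtain z where z: "c < z" "z < u" "f u - f c = (u - c) * deriv f z"
      using MVT2[of c u f "deriv f"] C2_DERIV by blast
    have "(u - c) * deriv f c \<le> (u - c) * deriv f z" "(u - c) * deriv f z < (u - c) * deriv f u"
      using z True strict_monoD[OF sm] by (auto simp: less_imp_le)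
    then show ?thesis using z(3) by (simp add: G_def algebra_simps)
  next
    case False
    then have uc: "u < c" using that by simp
    then obtain z where z: "u < z" "z < c" "f c - f u = (c - u) * deriv f z"
      using MVT2[of u c f "deriv f"] C2_DERIV by blast
    have "(c - u) * deriv f z \<le> (c - u) * deriv f c" "(c - u) * deriv f u < (c - u) * deriv f z"
      using z uc strict_monoD[OF sm] by (auto simp: less_imp_le)
    then show ?thesis using z(3) by (simp add: G_def algebra_simps)
  qed
  define y where "y t u = x0 - t * (deriv f u - deriv f c)" for t u
  \<comment> \<open>The contributions of the base point 0 cancel, and - t c (f'(u) - f'(c)) is
    rewritten as c (y - x0).\<close>
  have E_diff: "E_val f \<phi> u (x0 + t * deriv f c) t - E_val f \<phi> c (x0 + t * deriv f c) t
      = primitive \<phi> x0 + c * (y t u - x0) - primitive \<phi> (y t u) - t * G u" if "t > 0" for t u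
    by (simp add: E_val_eq[OF sm nonneg \<phi> that] y_def G_def algebra_simps)
  show ?thesis
  proof
    assume R: "\<forall>y. primitive \<phi> x0 + c * (y - x0) \<le> primitive \<phi> y"
    have lt: "E_val f \<phi> u (x0 + t * deriv f c) t < E_val f \<phi> c (x0 + t * deriv f c) t"
      if "t > 0" "u \<noteq> c" for t u
      using E_diff[of t u] R[rule_format, of "y t u"] G[of u] that
      by (smt (verit, best) mult_pos_pos)
    have "maximizers f \<phi> (x0 + t * deriv f c) t = {c}" if "t > 0" for t
    proof (intro set_eqI iffI)
      fix u assume "u \<in> maximizers f \<phi> (x0 + t * deriv f c) t"
      then show "u \<in> {c}"
        using lt[OF that, of u] by (force simp: maximizers_def not_le[symmetric])
    next
      fix u assume "u \<in> {c}"
      then show "u \<in> maximizers f \<phi> (x0 + t * deriv f c) t"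
        using lt[OF that] by (force simp: maximizers_def le_less)
    qed
    then show "c \<in> divide_values f \<phi> x0"
      by (auto simp: divide_values_def divide_line_def)
  next
    assume L: "c \<in> divide_values f \<phi> x0"
    have le: "primitive \<phi> x0 + c * (y t u - x0) - primitive \<phi> (y t u) \<le> t * G u"
      if "t > 0" for t u
    proof -
      have "maximizers f \<phi> (x0 + t * deriv f c) t = {c}"
        using L that by (auto simp: divide_values_def divide_line_def)
      then have "c \<in> maximizers f \<phi> (x0 + t * deriv f c) t" by simp
      then have "E_val f \<phi> u (x0 + t * deriv f c) t \<le> E_val f \<phi> c (x0 + t * deriv f c) t"
        by (simp add: maximizers_def)
      then show ?thesis using E_diff[OF that, of u] by simp
    qed
    show "\<forall>y. primitive \<phi> x0 + c * (y - x0) \<le> primitive \<phi> y"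
    proof
      fix z
      show "primitive \<phi> x0 + c * (z - x0) \<le> primitive \<phi> z"
      proof (cases "z = x0")
        case False
        \<comment> \<open>This sign selects the side of \<open>c\<close> on which f'(u) - f'(c) has
          the sign of \<open>x0 - z\<close>; then the \<open>t\<close> solving
          \<open>y t u = z\<close> is positive.\<close>
        define \<sigma> where "\<sigma> = sgn (x0 - z)"
        have \<sigma>: "\<sigma> \<noteq> 0" "\<bar>\<sigma>\<bar> = 1" using False by (auto simp: \<sigma>_def sgn_if)
        have bd: "primitive \<phi> x0 + c * (z - x0) - primitive \<phi> z \<le> \<bar>x0 - z\<bar> * e" if "e > 0" for e
        proof -
          define u where "u = c + \<sigma> * e"
          define t where "t = (x0 - z) / (deriv f u - deriv f c)"
          have u: "u \<noteq> c" using \<sigma> that by (simp add: u_def)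
          have d: "deriv f u - deriv f c \<noteq> 0"
            using strict_mono_eq[OF sm] u by simp
          have t: "t > 0"
          proof (cases "x0 < z")
            case True
            then have "u < c" using that by (simp add: u_def \<sigma>_def)
            then show ?thesis using strict_monoD[OF sm, of u c] True
              by (simp add: t_def divide_neg_neg)
          next
            case False
            then have "c < u" "z < x0" using that \<open>z \<noteq> x0\<close> by (simp_all add: u_def \<sigma>_def)
            then show ?thesis using strict_monoD[OF sm, of c u] by (simp add: t_def)
          qed
          have yz: "y t u = z" using d by (simp add: y_def t_def)
          have "t * G u \<le> t * ((u - c) * (deriv f u - deriv f c))"
            using G[OF u] t by simp
          also have "\<dots> = (x0 - z) * (\<sigma> * e)" using d by (simp add: t_def u_def)
          also have "\<dots> = \<bar>x0 - z\<bar> * e" by (simp add: \<sigma>_def abs_sgn)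
          finally show ?thesis using le[OF t, of u] by (simp add: yz)
        qed
        \<comment> \<open>Rescaling the distance from \<open>u\<close> to \<open>c\<close> by |x0 -
          z| turns the bound into an arbitrary positive error.\<close>
        have "primitive \<phi> x0 + c * (z - x0) - primitive \<phi> z \<le> 0 + e" if "e > 0" for e
          using bd[of "e / \<bar>x0 - z\<bar>"] that False by simp
        then have "primitive \<phi> x0 + c * (z - x0) - primitive \<phi> z \<le> 0"
          by (rule field_le_epsilon)
        then show ?thesis by simp
      qed simp
    qed
  qed
qed

end

section \<open>One-sided derivatives and subgradients of convex functions on the line\<close>

lemma convex_on_affine_real:
  fixes a b x0 :: real
  assumes "convex S"
  shows "convex_on S (\<lambda>y. a + b * (y - x0))"
  using assms by (intro convex_onI) (auto simp: algebra_simps)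

text \<open>Applied to difference quotients, this shows that the \<open>Lim\<close> in
  \<open>right_deriv\<close> is a genuine limit and evaluates it; the next result does the same for
  \<open>left_deriv\<close>.\<close>

lemma tendsto_at_right_Inf:
  fixes s :: "real \<Rightarrow> real"
  assumes mono: "\<And>u v. x < u \<Longrightarrow> u \<le> v \<Longrightarrow> s u \<le> s v" and bdd: "bdd_below (s ` {x<..})"
  shows "(s \<longlongrightarrow> Inf (s ` {x<..})) (at_right x)"
proof (rule order_tendstoI)
  fix a assume "a < Inf (s ` {x<..})"
  then have "a < s y" if "x < y" for y
    using cInf_lower[OF _ bdd, of "s y"] that by fastforce
  then show "\<forall>\<^sub>F y in at_right x. a < s y"
    by (auto intro: eventually_mono[OF eventually_at_right_less])
next
  fix a assume "Inf (s ` {x<..}) < a"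
  then obtain v where v: "x < v" "s v < a"
    using cInf_lessD[of "s ` {x<..}" a] by auto
  have "\<forall>\<^sub>F y in at_right x. y \<in> {x<..<v}"
    using v(1) by (rule eventually_at_right_real)
  then show "\<forall>\<^sub>F y in at_right x. s y < a"
  proof eventually_elim
    case (elim y)
    then show ?case using mono[of y v] v by simp
  qed
qed

lemma tendsto_at_left_Sup:
  fixes s :: "real \<Rightarrow> real"
  assumes mono: "\<And>u v. u \<le> v \<Longrightarrow> v < x \<Longrightarrow> s u \<le> s v" and bdd: "bdd_above (s ` {..<x})"
  shows "(s \<longlongrightarrow> Sup (s ` {..<x})) (at_left x)"
proof (rule order_tendstoI)
  fix a assume "a > Sup (s ` {..<x})"
  then have "a > s y" if "x > y" for y
    using cSup_upper[OF _ bdd, of "s y"] that by fastforce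
  then show "\<forall>\<^sub>F y in at_left x. a > s y"
    using eventually_at_left_real[of "x - 1" x] by (auto elim!: eventually_mono)
next
  fix a assume "Sup (s ` {..<x}) > a"
  then obtain v where v: "v < x" "s v > a"
    using less_cSupD[of "s ` {..<x}" a] by auto
  have "\<forall>\<^sub>F y in at_left x. y \<in> {v<..<x}"
    using v(1) by (rule eventually_at_left_real)
  then show "\<forall>\<^sub>F y in at_left x. s y > a"
  proof eventually_elim
    case (elim y)
    then show ?case using mono[of v y] v by simp
  qed
qed

lemma convex_on_slope_mono:
  fixes g :: "real \<Rightarrow> real"
  assumes g: "convex_on UNIV g" and "u \<le> v" "u \<noteq> x" "v \<noteq> x"
  shows "(g u - g x) / (u - x) \<le> (g v - g x) / (v - x)"
proof -
  have eq: "(g a - g b) / (a - b) = (g b - g a) / (b - a)" for a b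
    using minus_divide_divide[of "g b - g a" "b - a"] by simp
  consider "u = v" | "x < u" "u < v" | "u < x" "x < v" | "u < v" "v < x"
    using assms(2-4) by linarith
  then show ?thesis
  proof cases
    case 2
    then show ?thesis using convex_on_slope_le(1)[OF g, of x v u] eq[of x u] eq[of x v] by simp
  next
    case 3
    then show ?thesis using convex_on_slope_le[OF g, of u v x] eq[of x v] by simp
  next
    case 4
    then show ?thesis using convex_on_slope_le(2)[OF g, of u x v] by simp
  qed simp
qed

text \<open>Slopes from \<open>x\<close> increase with the other endpoint, so the one-sided
  derivatives are the infimum of the right slopes and the supremum of the left ones. Lying between
  them means separating all left slopes from all right slopes, which is the support inequality after
  multiplying by y - x.\<close>

lemma convex_on_subgradient_iff:
  assumes g: "convex_on UNIV g"
  shows "left_deriv g x \<le> c \<and> c \<le> right_deriv g x \<longleftrightarrow> (\<forall>y. g x + c * (y - x) \<le> g y)"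
proof -
  define s where "s y = (g y - g x) / (y - x)" for y
  have mono: "s u \<le> s v" if "u \<le> v" "u \<noteq> x" "v \<noteq> x" for u v
    unfolding s_def using convex_on_slope_mono[OF g that] .
  \<comment> \<open>Any single left slope bounds all right slopes from below, and
    conversely.\<close>
  have below: "bdd_below (s ` {x<..})"
    using mono[of "x - 1"] by (intro bdd_belowI[of _ "s (x - 1)"]) auto
  have above: "bdd_above (s ` {..<x})"
    using mono[of _ "x + 1"] by (intro bdd_aboveI[of _ "s (x + 1)"]) auto
  have "(s \<longlongrightarrow> Inf (s ` {x<..})) (at_right x)"
    by (rule tendsto_at_right_Inf[OF mono below]) auto
  then have R: "right_deriv g x = Inf (s ` {x<..})"
    unfolding right_deriv_def s_def[symmetric] by (intro tendsto_Lim) auto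
  have "(s \<longlongrightarrow> Sup (s ` {..<x})) (at_left x)"
    by (rule tendsto_at_left_Sup[OF mono above]) auto
  then have L: "left_deriv g x = Sup (s ` {..<x})"
    unfolding left_deriv_def s_def[symmetric] by (intro tendsto_Lim) auto
  have "c \<le> right_deriv g x \<longleftrightarrow> (\<forall>y>x. c \<le> s y)"
    unfolding R by (subst le_cInf_iff[OF _ below]) auto
  moreover have "left_deriv g x \<le> c \<longleftrightarrow> (\<forall>y<x. s y \<le> c)"
    unfolding L by (subst cSup_le_iff[OF _ above]) auto
  moreover have "c \<le> s y \<longleftrightarrow> g x + c * (y - x) \<le> g y" if "x < y" for y
    using that by (auto simp: s_def field_simps)
  moreover have "s y \<le> c \<longleftrightarrow> g x + c * (y - x) \<le> g y" if "y < x" for y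
    using that by (auto simp: s_def neg_divide_le_eq algebra_simps)
  moreover have "(\<forall>y. P y) \<longleftrightarrow> (\<forall>y<x. P y) \<and> (\<forall>y>x. P y)" if "P x" for P
    using that by (metis linorder_neqE)
  from this[of "\<lambda>y. g x + c * (y - x) \<le> g y"]
  have "(\<forall>y. g x + c * (y - x) \<le> g y)
    \<longleftrightarrow> (\<forall>y<x. g x + c * (y - x) \<le> g y) \<and> (\<forall>y>x. g x + c * (y - x) \<le> g y)"
    by simp
  ultimately show ?thesis by auto
qed

section \<open>Largest convex minorants, truncated hulls and their limit\<close>

lemma
  fixes g :: "real \<Rightarrow> real"
  assumes S: "convex S" and below: "\<And>y. y \<in> S \<Longrightarrow> m \<le> g y"
  shows convex_minorant_on_le: "x \<in> S \<Longrightarrow> convex_minorant_on S g x \<le> g x"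
    and le_convex_minorant_on: "\<lbrakk>convex_on S h; \<And>y. y \<in> S \<Longrightarrow> h y \<le> g y; x \<in> S\<rbrakk>
      \<Longrightarrow> h x \<le> convex_minorant_on S g x"
    and convex_on_convex_minorant_on: "convex_on S (convex_minorant_on S g)"
proof -
  define A where "A x = {h x |h. convex_on S h \<and> (\<forall>y\<in>S. h y \<le> g y)}" for x
  have cm: "convex_minorant_on S g x = Sup (A x)" for x
    by (simp add: convex_minorant_on_def A_def)
  have AI: "h x \<in> A x" if "convex_on S h" "\<And>y. y \<in> S \<Longrightarrow> h y \<le> g y" for h x
    using that unfolding A_def by blast
  \<comment> \<open>The constant \<open>m\<close> is a convex minorant; together with the upper
    bound \<open>g x\<close> on S it makes each \<open>Sup (A x)\<close> with x in S a true
    supremum.\<close>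
  have ne: "A x \<noteq> {}" for x
    using AI[of "\<lambda>_. m" x] below S by (auto simp: convex_on_const)
  have upper: "a \<le> g x" if "a \<in> A x" "x \<in> S" for a x
    using that by (auto simp: A_def)
  have le: "Sup (A x) \<le> g x" if "x \<in> S" for x
    by (rule cSup_least[OF ne]) (rule upper[OF _ that])
  have ge: "h x \<le> Sup (A x)"
    if "convex_on S h" "\<And>y. y \<in> S \<Longrightarrow> h y \<le> g y" "x \<in> S" for h x
    by (rule cSup_upper[OF AI[OF that(1,2)] bdd_aboveI[OF upper[OF _ that(3)]]])
  show "x \<in> S \<Longrightarrow> convex_minorant_on S g x \<le> g x"
    unfolding cm by (rule le)
  show "\<lbrakk>convex_on S h; \<And>y. y \<in> S \<Longrightarrow> h y \<le> g y; x \<in> S\<rbrakk> \<Longrightarrow> h x \<le> convex_minorant_on S g x"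
    unfolding cm by (rule ge)
  show "convex_on S (convex_minorant_on S g)"
  proof (rule convex_onI[OF _ S])
    fix t x y :: real assume t: "t > 0" "t < 1" and xy: "x \<in> S" "y \<in> S"
    show "convex_minorant_on S g ((1 - t) *\<^sub>R x + t *\<^sub>R y)
      \<le> (1 - t) * convex_minorant_on S g x + t * convex_minorant_on S g y"
      unfolding cm
    proof (rule cSup_least[OF ne])
      fix z assume "z \<in> A ((1 - t) *\<^sub>R x + t *\<^sub>R y)"
      then obtain h where h: "z = h ((1 - t) *\<^sub>R x + t *\<^sub>R y)" "convex_on S h"
          "\<And>y. y \<in> S \<Longrightarrow> h y \<le> g y"
        unfolding A_def by blast
      have "z \<le> (1 - t) * h x + t * h y"
        unfolding h(1) using t xy by (intro convex_onD[OF h(2)]) auto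
      also have "\<dots> \<le> (1 - t) * Sup (A x) + t * Sup (A y)"
        using ge[OF h(2,3)] t xy by (intro add_mono mult_left_mono) auto
      finally show "z \<le> (1 - t) * Sup (A x) + t * Sup (A y)" .
    qed
  qed
qed

context
  fixes g :: "real \<Rightarrow> real" and m :: "nat \<Rightarrow> real"
  assumes below: "\<And>N y. y \<in> {- real N..real N} \<Longrightarrow> m N \<le> g y"
begin

lemma truncated_hull_le: "truncated_hull g N x \<le> g x"
  using convex_minorant_on_le[of "{- real N..real N}" "m N" g x] below[of _ N]
  by (auto simp: truncated_hull_def abs_le_iff)

lemma convex_on_truncated_hull: "convex_on {- real N..real N} (truncated_hull g N)"
proof -
  have "convex_on {- real N..real N} (convex_minorant_on {- real N..real N} g)"
    by (rule convex_on_convex_minorant_on[OF _ below]) auto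
  moreover have "truncated_hull g N x = convex_minorant_on {- real N..real N} g x"
    if "x \<in> {- real N..real N}" for x
    using that by (auto simp: truncated_hull_def)
  ultimately show ?thesis
    using convexD[OF convex_real_interval(5)[of "- real N" "real N"]] by (simp add: convex_on_def)
qed

text \<open>Convexity matters only inside the interval, but h must lie below g everywhere, since
  outside it the truncated hull is g itself.\<close>

lemma le_truncated_hull:
  assumes "convex_on {- real N..real N} h" "\<And>y. h y \<le> g y"
  shows "h x \<le> truncated_hull g N x"
  using le_convex_minorant_on[of "{- real N..real N}" "m N" g h x] below[of _ N] assms
  by (auto simp: truncated_hull_def abs_le_iff)

text \<open>The hull for the larger interval, restricted to the smaller one, competes in the
  supremum defining the hull there.\<close>

lemma decseq_truncated_hull: "decseq (\<lambda>N. truncated_hull g N x)"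
proof (rule decseq_SucI)
  fix N
  have "convex_on {- real N..real N} (truncated_hull g (Suc N))"
    using convex_on_truncated_hull[of "Suc N"] by (rule convex_on_subset) auto
  then show "truncated_hull g (Suc N) x \<le> truncated_hull g N x"
    by (rule le_truncated_hull) (rule truncated_hull_le)
qed

text \<open>Monotone sequences converge in the extended reals, so the \<open>lim\<close> in
  \<open>convex_hull_fun\<close> is an actual limit, possibly -\<infinity>.\<close>

lemma truncated_hull_tendsto:
  "(\<lambda>N. ereal (truncated_hull g N x)) \<longlonglongrightarrow> convex_hull_fun g x"
proof -
  have "decseq (\<lambda>N. ereal (truncated_hull g N x))"
    using decseq_truncated_hull by (simp add: decseq_def)
  then show ?thesis
    unfolding convex_hull_fun_def convergent_LIMSEQ_iff[symmetric]
    using LIMSEQ_INF convergentI by blast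
qed

lemma convex_hull_fun_le: "convex_hull_fun g x \<le> ereal (g x)"
  by (rule LIMSEQ_le_const2[OF truncated_hull_tendsto]) (use truncated_hull_le in auto)

lemma affine_le_convex_hull_fun:
  assumes "\<And>y. a + b * (y - x0) \<le> g y"
  shows "ereal (a + b * (x - x0)) \<le> convex_hull_fun g x"
proof (rule LIMSEQ_le_const[OF truncated_hull_tendsto])
  have "a + b * (x - x0) \<le> truncated_hull g N x" for N
    by (rule le_truncated_hull[OF convex_on_affine_real assms]) simp
  then show "\<exists>N. \<forall>n\<ge>N. ereal (a + b * (x - x0)) \<le> ereal (truncated_hull g n x)"
    by simp
qed

text \<open>Once the interval contains both \<open>x\<close> and \<open>y\<close>, each truncated
  hull satisfies the convexity inequality; finiteness lets it pass to the limit in the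
  reals.\<close>

lemma convex_on_convex_hull_fun:
  assumes fin: "\<And>x. convex_hull_fun g x > -\<infinity>"
  shows "convex_on UNIV (\<lambda>x. real_of_ereal (convex_hull_fun g x))"
proof (rule convex_onI)
  fix t x y :: real assume t: "t > 0" "t < 1"
  have "convex_hull_fun g x = ereal (real_of_ereal (convex_hull_fun g x))" for x
    using fin[of x] convex_hull_fun_le[of x] by (cases "convex_hull_fun g x") auto
  then have lim: "(\<lambda>N. truncated_hull g N x) \<longlonglongrightarrow> real_of_ereal (convex_hull_fun g x)" for x
    using truncated_hull_tendsto[of x] lim_ereal by metis
  obtain n where n: "\<bar>x\<bar> \<le> real n" "\<bar>y\<bar> \<le> real n"
    using real_arch_simple[of "max \<bar>x\<bar> \<bar>y\<bar>"] by auto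
  have "truncated_hull g N ((1 - t) *\<^sub>R x + t *\<^sub>R y)
      \<le> (1 - t) * truncated_hull g N x + t * truncated_hull g N y" if "N \<ge> n" for N
    by (rule convex_onD[OF convex_on_truncated_hull[of N]]) (use t n that in auto)
  then show "real_of_ereal (convex_hull_fun g ((1 - t) *\<^sub>R x + t *\<^sub>R y))
      \<le> (1 - t) * real_of_ereal (convex_hull_fun g x) + t * real_of_ereal (convex_hull_fun g y)"
    by (intro LIMSEQ_le[OF lim tendsto_add[OF tendsto_mult_left[OF lim] tendsto_mult_left[OF lim]]]) auto
qed simp

lemma supporting_line_iff:
  assumes fin: "\<And>x. convex_hull_fun g x > -\<infinity>"
  defines "H \<equiv> \<lambda>x. real_of_ereal (convex_hull_fun g x)"
  shows "(\<forall>y. g x0 + c * (y - x0) \<le> g y)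
    \<longleftrightarrow> ereal (g x0) = convex_hull_fun g x0 \<and> left_deriv H x0 \<le> c \<and> c \<le> right_deriv H x0"
proof -
  have H: "convex_hull_fun g x = ereal (H x)" for x
    using fin[of x] convex_hull_fun_le[of x] by (cases "convex_hull_fun g x") (auto simp: H_def)
  have le: "H x \<le> g x" for x
    using convex_hull_fun_le[of x] by (simp add: H)
  have sub: "left_deriv H x0 \<le> c \<and> c \<le> right_deriv H x0 \<longleftrightarrow> (\<forall>y. H x0 + c * (y - x0) \<le> H y)"
    unfolding H_def by (rule convex_on_subgradient_iff[OF convex_on_convex_hull_fun[OF fin]])
  show ?thesis
    unfolding sub
  proof
    assume L: "\<forall>y. g x0 + c * (y - x0) \<le> g y"
    then have ge: "g x0 + c * (y - x0) \<le> H y" for y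
      using affine_le_convex_hull_fun[of "g x0" c x0 y] by (simp add: H)
    \<comment> \<open>At \<open>x0\<close> the line has the value \<open>g x0\<close>, squeezing the
      hull between equal bounds.\<close>
    then have "H x0 = g x0" using ge[of x0] le[of x0] by simp
    then show "ereal (g x0) = convex_hull_fun g x0 \<and> (\<forall>y. H x0 + c * (y - x0) \<le> H y)"
      using ge by (simp add: H)
  next
    assume "ereal (g x0) = convex_hull_fun g x0 \<and> (\<forall>y. H x0 + c * (y - x0) \<le> H y)"
    then show "\<forall>y. g x0 + c * (y - x0) \<le> g y"
      using le by (auto simp: H intro: order_trans)
  qed
qed

end

theorem theorem6p9:
  fixes f \<phi> :: "real \<Rightarrow> real"
  assumes "C2 f"
    and "\<forall>s. deriv (deriv f) s \<ge> 0"
    and "{s. deriv (deriv f) s = 0} \<in> null_sets lebesgue"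
    and "L_infinity \<phi>"
  shows "((\<forall>x. convex_hull_fun (primitive \<phi>) x > -\<infinity>) \<longrightarrow>
           (\<forall>x0 c. c \<in> divide_values f \<phi> x0 \<longleftrightarrow>
              ereal (primitive \<phi> x0) = convex_hull_fun (primitive \<phi>) x0 \<and>
              left_deriv (\<lambda>x. real_of_ereal (convex_hull_fun (primitive \<phi>) x)) x0 \<le> c \<and>
              c \<le> right_deriv (\<lambda>x. real_of_ereal (convex_hull_fun (primitive \<phi>) x)) x0)) \<and>
         ((\<forall>x. convex_hull_fun (primitive \<phi>) x = -\<infinity>) \<longrightarrow>
           (\<forall>x0. divide_values f \<phi> x0 = {}))"
proof -
  have nonneg: "\<forall>s. deriv (deriv f) s \<ge> 0" and \<phi>: "L_infinity \<phi>"
    using assms by auto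
  have sm: "strict_mono (deriv f)"
    by (rule C2_deriv_strict_mono[OF assms(1-3)])
  have D: "c \<in> divide_values f \<phi> x0 \<longleftrightarrow> (\<forall>y. primitive \<phi> x0 + c * (y - x0) \<le> primitive \<phi> y)" for c x0
    by (rule divide_values_iff[OF assms(1) sm nonneg \<phi>])
  obtain m where m: "\<And>N y. y \<in> {- real N..real N} \<Longrightarrow> m N \<le> primitive \<phi> y"
    using primitive_bounded_below[OF \<phi>] by blast
  show ?thesis
  proof (intro conjI impI allI)
    fix x0 c
    assume "\<forall>x. convex_hull_fun (primitive \<phi>) x > -\<infinity>"
    then show "c \<in> divide_values f \<phi> x0 \<longleftrightarrow>
        ereal (primitive \<phi> x0) = convex_hull_fun (primitive \<phi>) x0 \<and>
        left_deriv (\<lambda>x. real_of_ereal (convex_hull_fun (primitive \<phi>) x)) x0 \<le> c \<and>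
        c \<le> right_deriv (\<lambda>x. real_of_ereal (convex_hull_fun (primitive \<phi>) x)) x0"
      unfolding D by (intro supporting_line_iff[OF m]) auto
  next
    fix x0
    assume inf: "\<forall>x. convex_hull_fun (primitive \<phi>) x = -\<infinity>"
    show "divide_values f \<phi> x0 = {}"
    proof (rule equals0I)
      fix c assume "c \<in> divide_values f \<phi> x0"
      \<comment> \<open>A divide would give an affine minorant, hence a finite lower bound for the
        hull at \<open>x0\<close>.\<close>
      then have "primitive \<phi> x0 + c * (y - x0) \<le> primitive \<phi> y" for y
        by (simp add: D)
      from affine_le_convex_hull_fun[OF m this, where x = x0] show False
        using inf by simp
    qed
  qed
qed

end
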